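(* Let $G$ be either a right angled Artin group or a Coxeter group, with its standard finite symmetric generating set $S$. Then the cancelation norm of an element of $G$ does not depend on the representing word. That is, if $v$ and $w$ are two words in the alphabet $S$ representing the same element $g\in G$, then $|v|_\times=|w|_\times$, and so $|g|_\times=|w|_\times$ for every word $w$ representing $g$.
   Context: For a group $G$ generated by a finite symmetric set $S$ and a word $w=s_1\cdots s_n$ with $s_i\in S$, the cancelation length $|w|_\times$ is the least $k\ge 0$ such that deleting some $k$ of the letters $s_1,\dots,s_n$ from $w$ yields a word representing the identity of $G$. The cancelation norm of $g\in G$ is $|g|_\times=\min\{|w|_\times : w \text{ a word in } S \text{ representing } g\}$. A right angled Artin group is given by a finite simple graph $\Delta$: it has one generator for each vertex, and its defining relations are $st=ts$ for each edge $\{s,t\}$ of $\Delta$; here $S$ consists of the vertices and their inverses. A Coxeter group is given by a finite set $S$ with relations $s^2=1$ for $s\in S$ and $(st)^{m_{st}}=1$ for distinct $s,t\in S$, where $m_{st}=m_{ts}\in\{2,3,\dots\}\cup\{\infty\}$ (no relation if $m_{st}=\infty$); here $S$ is the set of Coxeter generators. *)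

theory Defs
  imports "HOL-Algebra.Group" "HOL-Library.Extended_Nat"
begin

section \<open>Cancelation length and cancelation norm\<close>

definition word_val :: "('a, 'b) monoid_scheme \<Rightarrow> 'a list \<Rightarrow> 'a" where
  "word_val G w = foldr (mult G) w (one G)"

definition represents :: "('a, 'b) monoid_scheme \<Rightarrow> 'a set \<Rightarrow> 'a list \<Rightarrow> 'a \<Rightarrow> bool" where
  "represents G S w g \<longleftrightarrow> set w \<subseteq> S \<and> word_val G w = g"

text \<open>The set \<open>I\<close> consists of the positions (not the values) of the deleted letters.\<close>

definition cancelation_length :: "('a, 'b) monoid_scheme \<Rightarrow> 'a list \<Rightarrow> nat" where
  "cancelation_length G w =
     (LEAST k. \<exists>I \<subseteq> {..<length w}. card I = k \<and> word_val G (nths w (- I)) = one G)"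

definition cancelation_norm :: "('a, 'b) monoid_scheme \<Rightarrow> 'a set \<Rightarrow> 'a \<Rightarrow> nat" where
  "cancelation_norm G S g =
     (LEAST k. \<exists>w. represents G S w g \<and> cancelation_length G w = k)"

section \<open>Groups given by generators and relations\<close>

text \<open>A formal letter \<open>(x, True)\<close> stands for the generator \<open>x\<close>, and \<open>(x, False)\<close> for its formal
  inverse. A relation \<open>l = r\<close> is the pair \<open>(l, r)\<close> of formal words.\<close>

type_synonym 'x fword = "('x \<times> bool) list"

definition fwords :: "'x set \<Rightarrow> 'x fword set" where
  "fwords X = lists (X \<times> UNIV)"

inductive_set pres_rel :: "'x set \<Rightarrow> ('x fword \<times> 'x fword) set \<Rightarrow> ('x fword \<times> 'x fword) set"
  for X R where
  refl: "u \<in> fwords X \<Longrightarrow> (u, u) \<in> pres_rel X R"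
| sym: "(u, v) \<in> pres_rel X R \<Longrightarrow> (v, u) \<in> pres_rel X R"
| trans: "(u, v) \<in> pres_rel X R \<Longrightarrow> (v, w) \<in> pres_rel X R \<Longrightarrow> (u, w) \<in> pres_rel X R"
| cancel: "u \<in> fwords X \<Longrightarrow> v \<in> fwords X \<Longrightarrow> x \<in> X
    \<Longrightarrow> (u @ [(x, b), (x, \<not> b)] @ v, u @ v) \<in> pres_rel X R"
| relation: "u \<in> fwords X \<Longrightarrow> v \<in> fwords X \<Longrightarrow> (l, r) \<in> R \<Longrightarrow> l \<in> fwords X \<Longrightarrow> r \<in> fwords X
    \<Longrightarrow> (u @ l @ v, u @ r @ v) \<in> pres_rel X R"

definition presented_group ::
    "'x set \<Rightarrow> ('x fword \<times> 'x fword) set \<Rightarrow> 'x fword set monoid" where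
  "presented_group X R =
     \<lparr> carrier = fwords X // pres_rel X R,
       mult = (\<lambda>A B. \<Union>u\<in>A. \<Union>v\<in>B. pres_rel X R `` {u @ v}),
       one = pres_rel X R `` {[]} \<rparr>"

definition pres_gen :: "'x set \<Rightarrow> ('x fword \<times> 'x fword) set \<Rightarrow> 'x \<Rightarrow> 'x fword set" where
  "pres_gen X R x = pres_rel X R `` {[(x, True)]}"

lemma pres_rel_fwords: "(u, v) \<in> pres_rel X R \<Longrightarrow> u \<in> fwords X \<and> v \<in> fwords X"
  by (induction rule: pres_rel.induct) (auto simp: fwords_def)

lemma equiv_pres_rel: "equiv (fwords X) (pres_rel X R)"
proof (rule equivI)
  show "pres_rel X R \<subseteq> fwords X \<times> fwords X"
    by (auto dest: pres_rel_fwords)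
  show "refl_on (fwords X) (pres_rel X R)"
    by (auto intro: refl_onI pres_rel.refl)
  show "sym (pres_rel X R)"
    by (auto intro: symI pres_rel.sym)
  show "trans (pres_rel X R)"
    by (auto intro: transI pres_rel.trans)
qed

lemma pres_rel_context:
  assumes "(u, v) \<in> pres_rel X R" "a \<in> fwords X" "b \<in> fwords X"
  shows "(a @ u @ b, a @ v @ b) \<in> pres_rel X R"
  using assms
proof (induction rule: pres_rel.induct)
  case (refl u)
  then show ?case by (intro pres_rel.refl) (auto simp: fwords_def)
next
  case (sym u v)
  then show ?case by (auto intro: pres_rel.sym)
next
  case (trans u v w)
  then show ?case by (auto intro: pres_rel.trans)
next
  case (cancel u v x c)
  then show ?case
    using pres_rel.cancel[of "a @ u" X "v @ b" x c R] by (auto simp: fwords_def)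
next
  case (relation u v l r)
  then show ?case
    using pres_rel.relation[of "a @ u" X "v @ b" l r R] by (auto simp: fwords_def)
qed

lemma pres_rel_append:
  assumes "(u, u') \<in> pres_rel X R" "(v, v') \<in> pres_rel X R"
  shows "(u @ v, u' @ v') \<in> pres_rel X R"
proof -
  have "(u @ v, u' @ v) \<in> pres_rel X R"
    using pres_rel_context[OF assms(1), of "[]" v] pres_rel_fwords[OF assms(2)]
    by (auto simp: fwords_def)
  moreover have "(u' @ v, u' @ v') \<in> pres_rel X R"
    using pres_rel_context[OF assms(2), of u' "[]"] pres_rel_fwords[OF assms(1)]
    by (auto simp: fwords_def)
  ultimately show ?thesis by (rule pres_rel.trans)
qed

lemma presented_group_mult:
  assumes "u \<in> fwords X" "v \<in> fwords X"
  shows "mult (presented_group X R) (pres_rel X R `` {u}) (pres_rel X R `` {v})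
    = pres_rel X R `` {u @ v}"
proof -
  have "congruent2 (pres_rel X R) (pres_rel X R) (\<lambda>u v. pres_rel X R `` {u @ v})"
    unfolding congruent2_def
    using equiv_class_eq[OF equiv_pres_rel] pres_rel_append by blast
  then show ?thesis
    using UN_equiv_class2[OF equiv_pres_rel equiv_pres_rel _ assms]
    by (simp add: presented_group_def)
qed

lemma fwords_inverse:
  assumes "u \<in> fwords X"
  shows "\<exists>v \<in> fwords X. (v @ u, []) \<in> pres_rel X R"
  using assms
proof (induction u)
  case Nil
  then show ?case by (auto intro!: bexI[of _ "[]"] pres_rel.refl)
next
  case (Cons p u)
  obtain x c where p: "p = (x, c)" by (cases p)
  have u: "u \<in> fwords X" and x: "x \<in> X" using Cons.prems p by (auto simp: fwords_def)
  obtain v where v: "v \<in> fwords X" "(v @ u, []) \<in> pres_rel X R" using Cons.IH u by blast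
  have "(v @ [(x, \<not> c), (x, \<not> \<not> c)] @ u, v @ u) \<in> pres_rel X R"
    by (rule pres_rel.cancel) (use u v x in auto)
  then have "((v @ [(x, \<not> c)]) @ p # u, []) \<in> pres_rel X R"
    using v(2) p by (auto intro: pres_rel.trans)
  moreover have "v @ [(x, \<not> c)] \<in> fwords X" using v x by (auto simp: fwords_def)
  ultimately show ?case by blast
qed

lemma group_presented_group: "group (presented_group X R)"
proof -
  let ?P = "presented_group X R" and ?c = "\<lambda>u. pres_rel X R `` {u}"
  have one: "one ?P = ?c []" and nil: "[] \<in> fwords X"
    by (auto simp: presented_group_def fwords_def)
  have car: "A \<in> carrier ?P \<longleftrightarrow> (\<exists>u \<in> fwords X. A = ?c u)" for A
    by (auto simp: presented_group_def quotient_def)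
  have app: "u @ v \<in> fwords X" if "u \<in> fwords X" "v \<in> fwords X" for u v
    using that by (auto simp: fwords_def)
  show ?thesis
  proof (rule groupI)
    fix A assume "A \<in> carrier ?P"
    then obtain u where u: "u \<in> fwords X" "A = ?c u" by (auto simp: car)
    then obtain v where v: "v \<in> fwords X" "(v @ u, []) \<in> pres_rel X R"
      using fwords_inverse by blast
    have "mult ?P (?c v) A = one ?P"
      using u v by (simp add: presented_group_mult one equiv_class_eq[OF equiv_pres_rel])
    moreover have "?c v \<in> carrier ?P" using v by (auto simp: car)
    ultimately show "\<exists>B \<in> carrier ?P. mult ?P B A = one ?P" by blast
  qed (auto simp: car one nil presented_group_mult app)
qed

section \<open>Right angled Artin groups and Coxeter groups\<close>

definition simple_graph :: "'v set \<Rightarrow> 'v set set \<Rightarrow> bool" where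
  "simple_graph V E \<longleftrightarrow> (\<forall>e \<in> E. e \<subseteq> V \<and> card e = 2)"

definition raag_relations :: "'v set set \<Rightarrow> ('v fword \<times> 'v fword) set" where
  "raag_relations E =
     {([(s, True), (t, True)], [(t, True), (s, True)]) | s t. {s, t} \<in> E}"

definition right_angled_Artin_group ::
    "'v set \<Rightarrow> 'v set set \<Rightarrow> ('a, 'b) monoid_scheme \<Rightarrow> 'a set \<Rightarrow> bool" where
  "right_angled_Artin_group V E G S \<longleftrightarrow>
     finite V \<and> simple_graph V E \<and> group G \<and>
     (\<exists>\<phi> \<in> iso (presented_group V (raag_relations E)) G.
        let T = \<phi> ` pres_gen V (raag_relations E) ` V in S = T \<union> m_inv G ` T)"

definition Coxeter_matrix :: "'s set \<Rightarrow> ('s \<Rightarrow> 's \<Rightarrow> enat) \<Rightarrow> bool" where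
  "Coxeter_matrix C m \<longleftrightarrow>
     (\<forall>s \<in> C. \<forall>t \<in> C. s \<noteq> t \<longrightarrow> m s t = m t s \<and> m s t \<ge> 2)"

definition Coxeter_relations ::
    "'s set \<Rightarrow> ('s \<Rightarrow> 's \<Rightarrow> enat) \<Rightarrow> ('s fword \<times> 's fword) set" where
  "Coxeter_relations C m =
     {([(s, True), (s, True)], []) | s. s \<in> C} \<union>
     {(concat (replicate k [(s, True), (t, True)]), []) | s t k.
        s \<in> C \<and> t \<in> C \<and> s \<noteq> t \<and> m s t = enat k}"

definition Coxeter_group ::
    "'s set \<Rightarrow> ('s \<Rightarrow> 's \<Rightarrow> enat) \<Rightarrow> ('a, 'b) monoid_scheme \<Rightarrow> 'a set \<Rightarrow> bool" where
  "Coxeter_group C m G S \<longleftrightarrow>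
     finite C \<and> Coxeter_matrix C m \<and> group G \<and>
     (\<exists>\<phi> \<in> iso (presented_group C (Coxeter_relations C m)) G.
        S = \<phi> ` pres_gen C (Coxeter_relations C m) ` C)"

end

theory Submission
  imports Defs "HOL-Library.Sublist"
begin

text \<open>
  The cancelation length of a word is a property of the group element because each elementary move
  of the presentation preserves it. Trivially, inserting a word that represents the identity never
  increases it: the inserted letters can all be kept. What has to be shown is that removing such a
  word does not increase it either.

  The free cancelation \<open>u s s\<inverse> v\<close> to \<open>u v\<close>: suppose that letters are deleted so that the rest is
  the identity. If both or none of \<open>s\<close>, \<open>s\<inverse>\<close> survive, the same rest of \<open>u v\<close> will do. If exactly
  one survives, the rest \<open>u' v'\<close> of \<open>u v\<close> represents a conjugate of a letter, and one further
  deletion is affordable, because a letter of the pair was deleted. So what is needed is an exchange property: a word representing a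
  conjugate of a letter becomes trivial after deleting one suitable letter.

  The exchange property comes from counting walls. In the Cayley graph label the edge from \<open>h\<close> to
  \<open>h s\<close>, for a generator \<open>s\<close>, by the conjugate \<open>h s h\<inverse>\<close>, and let \<open>crossings u \<tau>\<close> be the signed number
  of edges with label \<open>\<tau>\<close> on the path that starts at the identity and spells \<open>u\<close>. This is a crossed
  homomorphism on words. It respects the relations of a right angled Artin group exactly, and those
  of a Coxeter group modulo 2. If \<open>g s g\<inverse>\<close> is spelled by way of \<open>g\<close>, then \<open>s\<close>, then \<open>g\<inverse>\<close>, the path
  crosses the wall \<open>g s g\<inverse>\<close> once, since the two outer parts cancel each other. Hence every word
  \<open>u\<close> for \<open>g s g\<inverse>\<close> crosses it, in a right angled Artin group even in the right direction
  (\<open>crossings_conjugate\<close>). Deleting a letter at which \<open>u\<close> crosses the wall \<open>\<tau>\<close> multiplies its value by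
  \<open>\<tau>\<close> or \<open>\<tau>\<inverse>\<close> (\<open>delete_crossing\<close>), which makes it trivial.

  The remaining moves are local. For a commutation \<open>s t = t s\<close> the subwords of the two sides match.
  A Coxeter relator \<open>(s t)\<^sup>m\<close> is the alternating word \<open>s t s \<dots>\<close> of length \<open>m\<close>, followed by the reverse of
  the alternating word \<open>t s t \<dots>\<close> of length \<open>m\<close>. Every subword of the first alternating word has
  the same value as some subword of the second that is at least as long (\<open>dihedral_subword\<close>),
  because in a dihedral group a single deletion already produces every reflection, and two deletions
  produce every rotation. After this exchange, only letters \<open>s s\<close> and \<open>t t\<close> have to be
  cancelled.
\<close>

section \<open>Deleting positions and subsequences\<close>

lemma deletion_iff_subseq:
  "(\<exists>I \<subseteq> {..<length w}. card I = k \<and> P (nths w (- I)))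
     \<longleftrightarrow> (\<exists>z. subseq z w \<and> length z + k = length w \<and> P z)" (is "?L \<longleftrightarrow> ?R")
proof
  have len: "length (nths w (- I)) + card I = length w" if "I \<subseteq> {..<length w}" for I
  proof -
    have "{i. i < length w \<and> i \<in> - I} = {..<length w} - I" by auto
    then have "length (nths w (- I)) = length w - card I"
      using that by (simp add: length_nths card_Diff_subset finite_subset)
    moreover have "card I \<le> length w" using card_mono[OF _ that] by simp
    ultimately show ?thesis by simp
  qed
  show ?R if ?L
    using that len by (metis subseq_conv_nths)
  show ?L if ?R
  proof -
    obtain N where N: "length (nths w N) + k = length w" "P (nths w N)"
      using \<open>?R\<close> by (auto simp: subseq_conv_nths)
    let ?I = "{..<length w} - N"
    have "nths w (- ?I) = nths w N"
      unfolding nths_def by (rule arg_cong[of _ _ "map fst"], rule filter_cong) (auto simp: set_zip)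
    moreover have "?I \<subseteq> {..<length w}" by auto
    moreover have "length (nths w (- ?I)) + card ?I = length w"
      by (rule len) auto
    ultimately have "?I \<subseteq> {..<length w} \<and> card ?I = k \<and> P (nths w (- ?I))"
      using N by (metis add_left_cancel)
    then show ?L by blast
  qed
qed

lemma cancelation_length_subseq:
  "cancelation_length G w =
     (LEAST k. \<exists>z. subseq z w \<and> length z + k = length w \<and> word_val G z = one G)"
  unfolding cancelation_length_def by (simp only: deletion_iff_subseq[of w _ "\<lambda>z. word_val G z = one G"])

section \<open>Formal words in a group\<close>

lemma fwords_simps [simp]:
  "[] \<in> fwords X" "p # u \<in> fwords X \<longleftrightarrow> fst p \<in> X \<and> u \<in> fwords X"
  "u @ v \<in> fwords X \<longleftrightarrow> u \<in> fwords X \<and> v \<in> fwords X"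
  "rev u \<in> fwords X \<longleftrightarrow> u \<in> fwords X"
  by (auto simp: fwords_def mem_Times_iff)

lemma fwords_subseq: "subseq z u \<Longrightarrow> u \<in> fwords X \<Longrightarrow> z \<in> fwords X"
  by (induction rule: list_emb.induct) auto

lemma (in group) cancel_inv_left [simp]:
  assumes "a \<in> carrier G" "b \<in> carrier G"
  shows "a \<otimes> (inv a \<otimes> b) = b" "inv a \<otimes> (a \<otimes> b) = b"
  using assms by (simp_all flip: m_assoc)

lemma (in group) conjugate_eq_iff:
  assumes "a \<in> carrier G" "b \<in> carrier G" "\<tau> \<in> carrier G" "a \<otimes> b = b \<otimes> a"
  shows "b = inv a \<otimes> \<tau> \<otimes> a \<longleftrightarrow> b = \<tau>"
proof -
  have "inv a \<otimes> b \<otimes> a = b"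
    using assms by (simp add: m_assoc flip: assms(4))
  moreover have "\<tau> = a \<otimes> (inv a \<otimes> \<tau> \<otimes> a) \<otimes> inv a" "a \<otimes> b \<otimes> inv a = b"
    using assms by (simp_all add: m_assoc)
  ultimately show ?thesis by metis
qed

locale marked_group = group G for G :: "('a, 'b) monoid_scheme" (structure) +
  fixes X :: "'x set" and \<gamma> :: "'x \<Rightarrow> 'a"
  assumes gen_closed [simp, intro]: "x \<in> X \<Longrightarrow> \<gamma> x \<in> carrier G"
begin

definition letter :: "'x \<times> bool \<Rightarrow> 'a" where
  "letter p = (if snd p then \<gamma> (fst p) else inv (\<gamma> (fst p)))"

primrec val :: "'x fword \<Rightarrow> 'a" where
  "val [] = \<one>"
| "val (p # u) = letter p \<otimes> val u"

definition cost :: "'x fword \<Rightarrow> nat" where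
  "cost u = cancelation_length G (map letter u)"

lemma letter_closed [simp, intro]: "fst p \<in> X \<Longrightarrow> letter p \<in> carrier G"
  by (simp add: letter_def)

lemma val_closed [simp, intro]: "u \<in> fwords X \<Longrightarrow> val u \<in> carrier G"
  by (induction u) auto

lemma val_append: "u \<in> fwords X \<Longrightarrow> v \<in> fwords X \<Longrightarrow> val (u @ v) = val u \<otimes> val v"
  by (induction u) (auto simp: m_assoc)

lemma word_val_letters: "word_val G (map letter u) = val u"
  by (induction u) (auto simp: word_val_def)

lemma cost_LEAST:
  "cost u = (LEAST k. \<exists>z. subseq z u \<and> length z + k = length u \<and> val z = \<one>)"
proof -
  have *: "subseq z (map letter u) \<longleftrightarrow> (\<exists>z'. subseq z' u \<and> z = map letter z')" for z
    by (auto simp: subseq_conv_nths nths_map)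
  have "(\<exists>z. subseq z (map letter u) \<and> length z + k = length (map letter u) \<and> word_val G z = \<one>)
    \<longleftrightarrow> (\<exists>z. subseq z u \<and> length z + k = length u \<and> val z = \<one>)" for k
    unfolding * using word_val_letters by auto
  then show ?thesis by (simp add: cost_def cancelation_length_subseq)
qed

lemma cost_le:
  assumes "subseq z u" "val z = \<one>"
  shows "cost u + length z \<le> length u"
proof -
  have len: "length z \<le> length u" using assms(1) by (rule list_emb_length)
  have "cost u \<le> length u - length z"
    unfolding cost_LEAST using assms len by (intro Least_le) auto
  then show ?thesis using len by linarith
qed

lemma cost_attained:
  obtains z where "subseq z u" "val z = \<one>" "length z + cost u = length u"
proof -
  have "\<exists>k. \<exists>z. subseq z u \<and> length z + k = length u \<and> val z = \<one>"
    by (intro exI[of _ "length u"] exI[of _ "[]"]) auto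
  from LeastI_ex[OF this] show thesis
    using that unfolding cost_LEAST[symmetric] by blast
qed

text \<open>The form in which relations are used: a move that replaces the factor \<open>a\<close> by \<open>b\<close> does not
  increase the cancelation length as soon as each way of keeping part of \<open>a\<close> can be imitated in
  \<open>b\<close> with no more deletions.\<close>

lemma cost_replace:
  assumes "u \<in> fwords X" "v \<in> fwords X" "a \<in> fwords X" "b \<in> fwords X"
    and ab: "\<And>z. subseq z a \<Longrightarrow>
      \<exists>z'. subseq z' b \<and> val z' = val z \<and> length z + length b \<le> length z' + length a"
  shows "cost (u @ b @ v) \<le> cost (u @ a @ v)"
proof -
  obtain z where z: "subseq z (u @ a @ v)" "val z = \<one>"
    "length z + cost (u @ a @ v) = length (u @ a @ v)"
    by (rule cost_attained)
  obtain z1 z2 z3 where zs: "z = z1 @ z2 @ z3" "subseq z1 u" "subseq z2 a" "subseq z3 v"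
    using z(1) by (metis subseq_appendE)
  obtain z' where z': "subseq z' b" "val z' = val z2" "length z2 + length b \<le> length z' + length a"
    using ab[OF zs(3)] by blast
  have "val (z1 @ z' @ z3) = val z"
    using zs z' assms(1-4) by (simp add: val_append fwords_subseq)
  moreover have "subseq (z1 @ z' @ z3) (u @ b @ v)"
    using zs z' by (intro list_emb_append_mono)
  ultimately have "cost (u @ b @ v) + length (z1 @ z' @ z3) \<le> length (u @ b @ v)"
    using z(2) by (intro cost_le) auto
  then show ?thesis using z(3) z'(3) zs(1) by simp
qed

lemma cost_insert_trivial:
  assumes "u \<in> fwords X" "v \<in> fwords X" "a \<in> fwords X" "val a = \<one>"
  shows "cost (u @ a @ v) \<le> cost (u @ v)"
proof -
  have "cost (u @ a @ v) \<le> cost (u @ [] @ v)"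
    using assms by (intro cost_replace) (auto dest!: list_emb_Nil2 intro!: exI[of _ a])
  then show ?thesis by simp
qed

lemma val_letter_pair:
  assumes "fst p \<in> X" "fst q \<in> X" "letter p \<otimes> letter q = \<one>"
  shows "letter q = inv (letter p)"
  using assms by (metis inv_equality inv_inv letter_closed)

section \<open>The exchange property and free cancelation\<close>

text \<open>In a Coxeter group this is the case of the strong exchange condition in which the reflection
  is the value of the word itself.\<close>

definition exchange :: bool where
  "exchange \<longleftrightarrow> (\<forall>u \<in> fwords X. \<forall>g \<in> carrier G. \<forall>p. fst p \<in> X \<longrightarrow>
     val u = g \<otimes> letter p \<otimes> inv g \<longrightarrow>
     (\<exists>z. subseq z u \<and> length z + 1 = length u \<and> val z = \<one>))"

text \<open>The letters \<open>p\<close> and \<open>q\<close> need only be inverse in the group. This covers both the free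
  cancelation and the relation \<open>s s = 1\<close> of a Coxeter generator.\<close>

lemma cost_cancel_pair:
  assumes exchange "u \<in> fwords X" "v \<in> fwords X" "fst p \<in> X" "fst q \<in> X"
    and pq: "letter p \<otimes> letter q = \<one>"
  shows "cost (u @ [p, q] @ v) = cost (u @ v)"
proof (rule antisym)
  show "cost (u @ [p, q] @ v) \<le> cost (u @ v)"
    using assms by (intro cost_insert_trivial) auto
  have q: "letter q = inv (letter p)" and qX: "letter q \<in> carrier G" and pX: "letter p \<in> carrier G"
    using val_letter_pair assms by auto
  obtain z where z: "subseq z (u @ [p, q] @ v)" "val z = \<one>"
    "length z + cost (u @ [p, q] @ v) = length (u @ [p, q] @ v)"
    by (rule cost_attained)
  obtain z1 z2 z3 where zs: "z = z1 @ z2 @ z3" "subseq z1 u" "subseq z2 [p, q]" "subseq z3 v"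
    using z(1) by (metis subseq_appendE)
  have F: "z1 \<in> fwords X" "z3 \<in> fwords X" using zs assms by (auto intro: fwords_subseq)
  have sub: "subseq (z1 @ z3) (u @ v)" using zs by (intro list_emb_append_mono)
  have "z2 \<in> set (subseqs [p, q])" using zs(3) by (simp only: in_set_subseqs)
  then have "z2 = [] \<or> z2 = [p, q] \<or> z2 = [p] \<or> z2 = [q]"
    by (auto simp: Let_def simp del: in_set_subseqs)
  moreover have "letter p = inv (letter q)" using q pX by simp
  ultimately consider "z2 = [] \<or> z2 = [p, q]" 
    | r r' where "z2 = [r]" "fst r \<in> X" "fst r' \<in> X" "letter r' = inv (letter r)"
    using assms(4,5) q by metis
  then show "cost (u @ v) \<le> cost (u @ [p, q] @ v)"
  proof cases
    case 1
    then have "val (z1 @ z3) = \<one>"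
      using z(2) zs(1) pq F assms(4,5) q by (auto simp: val_append m_assoc)
    from cost_le[OF sub this] show ?thesis using z(3) zs(1) 1 by auto
  next
    case 2
    \<comment> \<open>Without the surviving letter \<open>r\<close>, what is kept of \<open>u v\<close> represents a conjugate of \<open>r\<inverse>\<close>. The
      letter that the exchange property deletes is paid for by the other letter of the pair, which
      was deleted before.\<close>
    have "val z1 \<otimes> (letter r \<otimes> val z3) = \<one>"
      using z(2) zs(1) 2 F by (simp add: val_append)
    then have "letter r \<otimes> val z3 = inv (val z1)"
      using F 2 by (metis inv_equality inv_inv letter_closed val_closed m_closed)
    then have "val z3 = letter r' \<otimes> inv (val z1)"
      using F 2 by (metis cancel_inv_left(2) letter_closed val_closed)
    then have "val (z1 @ z3) = val z1 \<otimes> letter r' \<otimes> inv (val z1)"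
      using F 2 by (simp add: val_append m_assoc)
    then obtain z' where z': "subseq z' (z1 @ z3)" "length z' + 1 = length (z1 @ z3)" "val z' = \<one>"
      using \<open>exchange\<close> F 2 unfolding exchange_def by (metis fwords_simps(3) val_closed)
    have "subseq z' (u @ v)"
      using z'(1) sub by (rule subseq_order.order_trans)
    from cost_le[OF this z'(3)] show ?thesis using z(3) zs(1) 2 z'(2) by simp
  qed
qed

section \<open>Signed crossings\<close>

text \<open>The path of \<open>u\<close> starts at the identity of the Cayley graph. A letter \<open>(x, True)\<close> or \<open>(x, False)\<close>
  read at \<open>h\<close> traverses an edge with label \<open>h \<otimes> \<gamma> x \<otimes> inv h\<close>, forwards or backwards. The
  recursion moves the base point of the remaining path back to the identity, which conjugates \<open>\<tau>\<close>.\<close>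

primrec crossings :: "'x fword \<Rightarrow> 'a \<Rightarrow> int" where
  "crossings [] \<tau> = 0"
| "crossings (p # u) \<tau> =
     (if \<gamma> (fst p) = \<tau> then if snd p then 1 else - 1 else 0)
       + crossings u (inv (letter p) \<otimes> \<tau> \<otimes> letter p)"

lemma crossings_append:
  assumes "u \<in> fwords X" "v \<in> fwords X" "\<tau> \<in> carrier G"
  shows "crossings (u @ v) \<tau> = crossings u \<tau> + crossings v (inv (val u) \<otimes> \<tau> \<otimes> val u)"
  using assms by (induction u arbitrary: \<tau>) (auto simp: m_assoc inv_mult_group)

lemma crossings_pair:
  assumes "x \<in> X" "\<tau> \<in> carrier G"
  shows "crossings [(x, b), (x, \<not> b)] \<tau> = 0"
  using assms conjugate_eq_iff[of "letter (x, b)" "\<gamma> x" \<tau>]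
  by (cases b) (auto simp: letter_def)

lemma crossings_commuting:
  assumes "x \<in> X" "y \<in> X" "\<gamma> x \<otimes> \<gamma> y = \<gamma> y \<otimes> \<gamma> x" "\<tau> \<in> carrier G"
  shows "crossings [(x, True), (y, True)] \<tau> = of_bool (\<gamma> x = \<tau>) + of_bool (\<gamma> y = \<tau>)"
  using assms conjugate_eq_iff[of "\<gamma> x" "\<gamma> y" \<tau>] by (simp add: letter_def)

text \<open>If \<open>u = u1 p u2\<close> crosses \<open>\<tau>\<close> forwards at \<open>p\<close>, then \<open>\<tau>\<close> is the conjugate of \<open>p\<close> by
  \<open>u1\<close>, and \<open>u1 u2\<close> has the value \<open>inv \<tau> \<otimes> val u\<close>. A count of positive sign guarantees
  such a letter, and one of negative sign a backward crossing.\<close>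

lemma delete_crossing:
  assumes "u \<in> fwords X" "\<tau> \<in> carrier G" "crossings u \<tau> \<noteq> 0"
  shows "\<exists>z. subseq z u \<and> length z + 1 = length u \<and>
    val z = (if crossings u \<tau> > 0 then inv \<tau> else \<tau>) \<otimes> val u"
  using assms
proof (induction u arbitrary: \<tau>)
  case Nil
  then show ?case by simp
next
  case (Cons p u)
  let ?s = "if \<gamma> (fst p) = \<tau> then if snd p then 1 else - 1 else 0 :: int"
  let ?\<sigma> = "inv (letter p) \<otimes> \<tau> \<otimes> letter p"
  have X: "fst p \<in> X" "u \<in> fwords X" "letter p \<in> carrier G" "val u \<in> carrier G" "?\<sigma> \<in> carrier G"
    using Cons.prems by auto
  consider "?s > 0" "crossings (p # u) \<tau> > 0" | "?s < 0" "crossings (p # u) \<tau> < 0"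
    | "crossings u ?\<sigma> > 0" "crossings (p # u) \<tau> > 0" | "crossings u ?\<sigma> < 0" "crossings (p # u) \<tau> < 0"
    using Cons.prems(3) by (simp only: crossings.simps) linarith
  then show ?case
  proof cases
    case 1
    then have "val u = inv \<tau> \<otimes> val (p # u)" using X by (auto simp: letter_def split: if_splits)
    then show ?thesis using 1 by (intro exI[of _ u]) auto
  next
    case 2
    then have "val u = \<tau> \<otimes> val (p # u)" using X by (auto simp: letter_def split: if_splits)
    then show ?thesis using 2 by (intro exI[of _ u]) auto
  next
    case 3
    then obtain z where z: "subseq z u" "length z + 1 = length u" "val z = inv ?\<sigma> \<otimes> val u"
      using Cons.IH[of ?\<sigma>] X by auto
    have "val (p # z) = inv \<tau> \<otimes> val (p # u)"
      using X Cons.prems(2) by (simp add: z(3) inv_mult_group m_assoc)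
    then show ?thesis using 3 z by (intro exI[of _ "p # z"]) auto
  next
    case 4
    then obtain z where z: "subseq z u" "length z + 1 = length u" "val z = ?\<sigma> \<otimes> val u"
      using Cons.IH[of ?\<sigma>] X by auto
    have "val (p # z) = \<tau> \<otimes> val (p # u)"
      using X Cons.prems(2) by (simp add: z(3) inv_mult_group m_assoc)
    then show ?thesis using 4 z by (intro exI[of _ "p # z"]) auto
  qed
qed

end

section \<open>Dihedral words\<close>

lemma (in group) pow_shift:
  assumes "a \<in> carrier G" "b \<in> carrier G"
  shows "a \<otimes> (b \<otimes> a) [^] (k::nat) = (a \<otimes> b) [^] k \<otimes> a"
proof (induction k)
  case 0
  then show ?case using assms by simp
next
  case (Suc k)
  have "a \<otimes> (b \<otimes> a) [^] Suc k = (a \<otimes> (b \<otimes> a) [^] k) \<otimes> (b \<otimes> a)"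
    using assms by (simp add: m_assoc)
  then show ?case using assms by (simp add: Suc m_assoc)
qed

primrec alt :: "'c \<Rightarrow> 'c \<Rightarrow> nat \<Rightarrow> 'c list" where
  "alt a b 0 = []"
| "alt a b (Suc n) = a # alt b a n"

lemma length_alt [simp]: "length (alt a b n) = n"
  by (induction n arbitrary: a b) auto

lemma set_alt: "set (alt a b n) \<subseteq> {a, b}"
  by (induction n arbitrary: a b) (simp, fastforce)

lemma alt_fwords: "fst p \<in> X \<Longrightarrow> fst q \<in> X \<Longrightarrow> alt p q n \<in> fwords X"
  by (induction n arbitrary: p q) auto

text \<open>Cutting \<open>a b a b \<dots>\<close> in half: since the word ends with \<open>b\<close>, its second half read backwards is
  the alternating word that starts with \<open>b\<close>, whatever the parity of \<open>n\<close>.\<close>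

lemma alt_append_rev_alt: "alt a b n @ rev (alt b a n) = concat (replicate n [a, b])"
proof (induction n arbitrary: a b)
  case 0
  then show ?case by simp
next
  case (Suc n)
  have "alt a b (Suc n) @ rev (alt b a (Suc n)) = a # concat (replicate n [b, a]) @ [b]"
    using Suc[of b a] by simp
  also have "\<dots> = concat (replicate (Suc n) [a, b])"
    by (induction n) auto
  finally show ?case .
qed

lemma alt_double: "alt a b (2 * n) = concat (replicate n [a, b])"
  by (induction n) auto

context marked_group
begin

lemma crossings_alt:
  assumes "x \<in> X" "y \<in> X" "\<tau> \<in> carrier G"
    and inv: "\<gamma> x \<otimes> \<gamma> x = \<one>" "\<gamma> y \<otimes> \<gamma> y = \<one>"
  shows "crossings (alt (x, True) (y, True) n) \<tau>
    = (\<Sum>i<n. if (\<gamma> x \<otimes> \<gamma> y) [^] i \<otimes> \<gamma> x = \<tau> then 1 else 0)"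
  using assms
proof (induction n arbitrary: x y \<tau>)
  case 0
  then show ?case by simp
next
  case (Suc n)
  let ?a = "\<gamma> x" and ?b = "\<gamma> y"
  have ab: "?a \<in> carrier G" "?b \<in> carrier G" using Suc.prems by auto
  have aa: "?a \<otimes> (?a \<otimes> c) = c" if "c \<in> carrier G" for c
    using Suc.prems(4) ab that by (simp flip: m_assoc)
  have a: "inv ?a = ?a" using Suc.prems(4) ab by (simp add: inv_equality)
  have "(?b \<otimes> ?a) [^] i \<otimes> ?b = inv ?a \<otimes> \<tau> \<otimes> ?a \<longleftrightarrow> (?a \<otimes> ?b) [^] Suc i \<otimes> ?a = \<tau>" for i
  proof -
    have "(?a \<otimes> ?b) [^] Suc i \<otimes> ?a = (?a \<otimes> (?b \<otimes> ?a) [^] i) \<otimes> (?b \<otimes> ?a)"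
      using ab by (simp add: m_assoc pow_shift)
    then have "(?a \<otimes> ?b) [^] Suc i \<otimes> ?a = ?a \<otimes> ((?b \<otimes> ?a) [^] i \<otimes> ?b) \<otimes> ?a"
      using ab by (simp add: m_assoc)
    moreover have "?a \<otimes> (?a \<otimes> c \<otimes> ?a) \<otimes> ?a = c" if "c \<in> carrier G" for c
      using ab aa Suc.prems(4) that by (simp add: m_assoc)
    moreover have "(?b \<otimes> ?a) [^] i \<otimes> ?b \<in> carrier G" using ab by simp
    ultimately show ?thesis using a Suc.prems(3) by metis
  qed
  moreover have "crossings (alt (y, True) (x, True) n) (inv ?a \<otimes> \<tau> \<otimes> ?a)
    = (\<Sum>i<n. if (?b \<otimes> ?a) [^] i \<otimes> ?b = inv ?a \<otimes> \<tau> \<otimes> ?a then 1 else 0)"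
    using Suc.prems by (intro Suc.IH) auto
  ultimately show ?case
    using ab by (simp add: letter_def sum.lessThan_Suc_shift del: nat_pow_Suc sum.lessThan_Suc)
qed

text \<open>The path of \<open>(s t)\<^sup>n\<close> crosses the walls \<open>(s t)\<^sup>i s\<close> for \<open>i < 2 n\<close>, and this list of walls repeats
  itself after \<open>n\<close> steps.\<close>

lemma crossings_power_word_even:
  assumes "x \<in> X" "y \<in> X" "\<tau> \<in> carrier G"
    and inv: "\<gamma> x \<otimes> \<gamma> x = \<one>" "\<gamma> y \<otimes> \<gamma> y = \<one>"
    and pow: "(\<gamma> x \<otimes> \<gamma> y) [^] n = \<one>"
  shows "2 dvd crossings (concat (replicate n [(x, True), (y, True)])) \<tau>"
proof -
  define f :: "nat \<Rightarrow> int" where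
    "f i = (if (\<gamma> x \<otimes> \<gamma> y) [^] i \<otimes> \<gamma> x = \<tau> then 1 else 0)" for i
  have period: "f (n + i) = f i" for i
    using assms unfolding f_def by (simp flip: nat_pow_mult)
  have "(\<Sum>i<n + k. f i) = (\<Sum>i<n. f i) + (\<Sum>i<k. f (n + i))" for k
    by (induction k) auto
  then have "(\<Sum>i<2 * n. f i) = 2 * (\<Sum>i<n. f i)"
    by (simp only: period mult_2)
  moreover have "crossings (concat (replicate n [(x, True), (y, True)])) \<tau> = (\<Sum>i<2 * n. f i)"
    unfolding f_def alt_double[symmetric] by (rule crossings_alt[OF assms(1-5)])
  ultimately show ?thesis by simp
qed

text \<open>Deleting the letter at position \<open>i\<close> multiplies the value of the word by the reflection whose
  wall is crossed there.\<close>

lemma alt_delete: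
  assumes "fst p \<in> X" "fst q \<in> X" "letter p \<otimes> letter p = \<one>" "letter q \<otimes> letter q = \<one>" "i < n"
  shows "\<exists>z. subseq z (alt p q n) \<and> length z + 1 = n \<and>
    val z = (letter p \<otimes> letter q) [^] i \<otimes> letter p \<otimes> val (alt p q n)"
  using assms
proof (induction n arbitrary: p q i)
  case 0
  then show ?case by simp
next
  case (Suc n)
  let ?s = "letter p" and ?t = "letter q" and ?v = "val (alt q p n)"
  have X: "?s \<in> carrier G" "?t \<in> carrier G" "?v \<in> carrier G"
    using Suc.prems by (auto intro: alt_fwords)
  have ss: "?s \<otimes> (?s \<otimes> c) = c" if "c \<in> carrier G" for c
    using Suc.prems(3) X that by (simp flip: m_assoc)
  show ?case
  proof (cases i)
    case 0
    then show ?thesis using X ss by (intro exI[of _ "alt q p n"]) auto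
  next
    case (Suc j)
    then obtain z where z: "subseq z (alt q p n)" "length z + 1 = n"
        "val z = (?t \<otimes> ?s) [^] j \<otimes> ?t \<otimes> ?v"
      using Suc.IH[of q p j] Suc.prems by auto
    have "val (p # z) = (?s \<otimes> (?t \<otimes> ?s) [^] j) \<otimes> ?t \<otimes> ?v"
      using X z by (simp add: m_assoc)
    also have "\<dots> = (?s \<otimes> ?t) [^] Suc j \<otimes> ?s \<otimes> val (alt p q (Suc n))"
      using X ss by (simp add: pow_shift m_assoc)
    finally show ?thesis using z Suc by (intro exI[of _ "p # z"]) auto
  qed
qed

text \<open>The exponent can be kept natural because \<open>t = (s t)\<^bsup>m - 1\<^esup> s\<close> when \<open>(s t)\<^sup>m = 1\<close>.\<close>

lemma dihedral_normal_form:
  assumes X: "fst p \<in> X" "fst q \<in> X" and inv: "letter p \<otimes> letter p = \<one>" "letter q \<otimes> letter q = \<one>"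
    and pow: "(letter p \<otimes> letter q) [^] (m::nat) = \<one>" and m: "m > 0" and w: "set w \<subseteq> {p, q}"
  shows "\<exists>l < m. val w = (letter p \<otimes> letter q) [^] l \<otimes> (if even (length w) then \<one> else letter p)"
proof -
  let ?s = "letter p" and ?t = "letter q"
  have C: "?s \<in> carrier G" "?t \<in> carrier G" using X by auto
  have "\<exists>l::nat. val w = (?s \<otimes> ?t) [^] l \<otimes> (if even (length w) then \<one> else ?s)"
    using w
  proof (induction w rule: rev_induct)
    case Nil
    then show ?case by (intro exI[of _ 0]) simp
  next
    case (snoc a w)
    then obtain l :: nat where
      l: "val w = (?s \<otimes> ?t) [^] l \<otimes> (if even (length w) then \<one> else ?s)" by auto
    have "w \<in> fwords X" using snoc.prems X by (auto simp: fwords_def mem_Times_iff)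
    then have wa: "val (w @ [a]) = val w \<otimes> letter a"
      using snoc.prems X by (auto simp: val_append)
    consider "a = p" | "a = q" "odd (length w)" | "a = q" "even (length w)"
      using snoc.prems by auto
    then show ?case
    proof cases
      case 1
      then show ?thesis using C inv l wa by (intro exI[of _ l]) (auto simp: m_assoc)
    next
      case 2
      then show ?thesis using C inv l wa by (intro exI[of _ "Suc l"]) (auto simp: m_assoc)
    next
      case 3
      have "(?s \<otimes> ?t) [^] (l + (m - 1)) \<otimes> ?s = (?s \<otimes> ?t) [^] (l + (m - 1)) \<otimes> (?s \<otimes> ?t) \<otimes> ?t"
        using C inv by (simp add: m_assoc)
      also have "\<dots> = (?s \<otimes> ?t) [^] (l + m) \<otimes> ?t"
        using C m by (cases m) auto
      also have "\<dots> = (?s \<otimes> ?t) [^] l \<otimes> ?t"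
        using C pow by (simp flip: nat_pow_mult)
      finally show ?thesis using 3 l wa C by (intro exI[of _ "l + (m - 1)"]) auto
    qed
  qed
  then obtain l :: nat where
    l: "val w = (?s \<otimes> ?t) [^] l \<otimes> (if even (length w) then \<one> else ?s)" by blast
  have "(?s \<otimes> ?t) [^] l = (?s \<otimes> ?t) [^] (m * (l div m) + l mod m)" by simp
  also have "\<dots> = ((?s \<otimes> ?t) [^] m) [^] (l div m) \<otimes> (?s \<otimes> ?t) [^] (l mod m)"
    using C by (simp only: nat_pow_mult nat_pow_pow m_closed)
  also have "\<dots> = (?s \<otimes> ?t) [^] (l mod m)"
    using C pow by simp
  finally show ?thesis using l m by (intro exI[of _ "l mod m"]) auto
qed

lemma val_rev_involutions:
  assumes "u \<in> fwords X" "\<And>p. p \<in> set u \<Longrightarrow> letter p \<otimes> letter p = \<one>"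
  shows "val (rev u) = inv (val u)"
  using assms
proof (induction u)
  case Nil
  then show ?case by simp
next
  case (Cons p u)
  then have "letter p = inv (letter p)" using inv_equality[of "letter p" "letter p"] by simp
  then show ?case using Cons by (simp add: val_append inv_mult_group)
qed

text \<open>Let \<open>b\<close> be the value of the alternating word \<open>t s t \<dots>\<close> of length \<open>m\<close>. The value of \<open>z\<close> is
  \<open>\<rho> b\<close> for an element \<open>\<rho>\<close> of the dihedral group whose type is determined by the parity of the
  number of missing letters. If this number is odd, \<open>\<rho>\<close> is a reflection, and the alternating word
  crosses each of these, so one deletion suffices. If it is even, it is at least 2, and \<open>\<rho>\<close> is
  a rotation: it is trivial, or it is a product of the first reflection with some later one,
  so that two deletions suffice.\<close>

lemma dihedral_subword:
  assumes X: "fst p \<in> X" "fst q \<in> X" and inv: "letter p \<otimes> letter p = \<one>" "letter q \<otimes> letter q = \<one>"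
    and pow: "(letter p \<otimes> letter q) [^] (m::nat) = \<one>" and z: "set z \<subseteq> {p, q}" "length z < m"
  shows "\<exists>z'. subseq z' (alt q p m) \<and> val z' = val z \<and> length z \<le> length z'"
proof -
  let ?s = "letter p" and ?t = "letter q" and ?b = "val (alt q p m)"
  have C: "?s \<in> carrier G" "?t \<in> carrier G" "?b \<in> carrier G"
    using X by (auto intro: alt_fwords)
  have F: "z \<in> fwords X" "alt q p m \<in> fwords X"
    using X z by (force simp: fwords_def mem_Times_iff, intro alt_fwords)
  have "set (z @ rev (alt q p m)) \<subseteq> {p, q}"
    using z set_alt[of q p m] by auto
  then obtain l where l: "l < m"
    "val (z @ rev (alt q p m)) = (?s \<otimes> ?t) [^] l \<otimes> (if even (length z + m) then \<one> else ?s)"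
    using dihedral_normal_form[OF X inv pow, of "z @ rev (alt q p m)"] z by auto
  have "val (rev (alt q p m)) = inv ?b"
    using F inv set_alt[of q p m] by (intro val_rev_involutions) auto
  then have "val z = val (z @ rev (alt q p m)) \<otimes> ?b"
    using F C by (simp add: val_append m_assoc)
  then have vz: "val z = (?s \<otimes> ?t) [^] l \<otimes> (if even (length z + m) then ?b else ?s \<otimes> ?b)"
    using l(2) C by (auto simp: m_assoc)
  obtain m' where m': "m = Suc m'" using z(2) by (cases m) auto
  show ?thesis
  proof (cases "even (length z + m)")
    case odd: False
    \<comment> \<open>The reflections crossed by \<open>t s t \<dots>\<close> are \<open>(t s)\<^sup>i t = (s t)\<^bsup>m - 1 - i\<^esup> s\<close>, so the letter to
      delete is the one at position \<open>i = m - 1 - l\<close>.\<close>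
    have "?t \<otimes> ?s = inv (?s \<otimes> ?t)"
      using C inv by (simp add: inv_mult_group inv_equality)
    then have ts: "(?t \<otimes> ?s) [^] (m' - l) = inv ((?s \<otimes> ?t) [^] (m' - l))"
      using C by (simp add: nat_pow_inv)
    have "((?s \<otimes> ?t) [^] m' \<otimes> ?s) \<otimes> ?t = \<one>"
      using C pow m' by (simp add: m_assoc)
    then have "(?s \<otimes> ?t) [^] m' \<otimes> ?s = ?t"
      using C inv(2) by (metis inv_equality inv_inv m_closed nat_pow_closed)
    moreover have "(?s \<otimes> ?t) [^] m' = (?s \<otimes> ?t) [^] (m' - l) \<otimes> (?s \<otimes> ?t) [^] l"
      using C l(1) m' by (simp add: nat_pow_mult)
    ultimately have "?t = (?s \<otimes> ?t) [^] (m' - l) \<otimes> ((?s \<otimes> ?t) [^] l \<otimes> ?s)"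
      using C by (simp add: m_assoc)
    have eq: "(?t \<otimes> ?s) [^] (m' - l) \<otimes> ?t = (?s \<otimes> ?t) [^] l \<otimes> ?s"
      unfolding ts using C by (subst (2) \<open>?t = _\<close>) simp
    have "m' - l < m" using m' by simp
    obtain z' where z': "subseq z' (alt q p m)" "length z' + 1 = m"
      "val z' = (?t \<otimes> ?s) [^] (m' - l) \<otimes> ?t \<otimes> ?b"
      using alt_delete[OF X(2,1) inv(2,1), of "m' - l" m] \<open>m' - l < m\<close> by blast
    have "val z' = val z" using z'(3) eq vz odd C by (simp add: m_assoc)
    then show ?thesis using z' z by (intro exI[of _ z']) auto
  next
    case even: True
    show ?thesis
    proof (cases l)
      case 0
      then show ?thesis using vz even z C by (intro exI[of _ "alt q p m"]) auto
    next
      case (Suc j)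
      \<comment> \<open>Delete the first letter \<open>t\<close> and, in the remaining alternating word, the letter at
        position \<open>l - 1\<close>.\<close>
      let ?v = "val (alt p q m')"
      have v: "?v \<in> carrier G" using X by (auto intro: alt_fwords)
      obtain z' where z': "subseq z' (alt p q m')" "length z' + 1 = m'"
        "val z' = (?s \<otimes> ?t) [^] j \<otimes> ?s \<otimes> ?v"
        using alt_delete[OF X inv, of j m'] m' l(1) Suc by auto
      have "val z = (?s \<otimes> ?t) [^] j \<otimes> ?s \<otimes> (?t \<otimes> ?t \<otimes> ?v)"
        using vz even Suc m' C v by (simp add: m_assoc)
      then have "val z' = val z" using z'(3) inv C v by simp
      moreover have "length z \<le> length z'" using even z z'(2) m' by presburger
      moreover have "subseq z' (alt q p m)" using z'(1) m' by auto
      ultimately show ?thesis by blast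
    qed
  qed
qed


lemma val_power_word:
  assumes "fst p \<in> X" "fst q \<in> X"
  shows "val (concat (replicate n [p, q])) = (letter p \<otimes> letter q) [^] n"
proof (induction n)
  case 0
  then show ?case by simp
next
  case (Suc n)
  have "letter p \<otimes> letter q \<in> carrier G" using assms by simp
  then show ?case using assms nat_pow_Suc2[of "letter p \<otimes> letter q" n]
    by (simp add: Suc m_assoc del: nat_pow_Suc)
qed

text \<open>A proper subword is treated by \<open>dihedral_subword\<close>, and the full word by the braid relation
  \<open>s t s \<dots> = t s t \<dots>\<close>.\<close>

lemma cost_braid:
  assumes X: "fst p \<in> X" "fst q \<in> X" and inv: "letter p \<otimes> letter p = \<one>" "letter q \<otimes> letter q = \<one>"
    and pow: "(letter p \<otimes> letter q) [^] (m::nat) = \<one>" and uv: "u \<in> fwords X" "v \<in> fwords X"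
  shows "cost (u @ alt q p m @ v) \<le> cost (u @ alt p q m @ v)"
proof (rule cost_replace)
  have F: "alt p q m \<in> fwords X" "alt q p m \<in> fwords X" using X by (auto intro: alt_fwords)
  fix z assume z: "subseq z (alt p q m)"
  show "\<exists>z'. subseq z' (alt q p m) \<and> val z' = val z \<and>
      length z + length (alt q p m) \<le> length z' + length (alt p q m)"
  proof (cases "length z = m")
    case True
    then have "z = alt p q m" using z by (metis subseq_same_length length_alt)
    have "val (rev (alt q p m)) = inv (val (alt q p m))"
      using F inv set_alt[of q p m] by (intro val_rev_involutions) auto
    moreover have "val (alt p q m @ rev (alt q p m)) = \<one>"
      unfolding alt_append_rev_alt using X pow by (simp add: val_power_word)
    ultimately have "val (alt p q m) \<otimes> inv (val (alt q p m)) = \<one>"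
      using F by (simp add: val_append)
    then have "val (alt p q m) = val (alt q p m)"
      using F by (metis inv_equality inv_inv inv_closed val_closed)
    then show ?thesis using \<open>z = alt p q m\<close> by auto
  next
    case False
    then have "length z < m" using list_emb_length[OF z] by simp
    moreover have "set z \<subseteq> {p, q}"
      using z set_alt[of p q m] by (metis set_nths_subset subseq_conv_nths subset_trans)
    ultimately show ?thesis using dihedral_subword[OF X inv pow] by simp
  qed
qed (use X uv in \<open>auto intro: alt_fwords\<close>)

lemma cost_cancel_rev:
  assumes exchange "u \<in> fwords X" "v \<in> fwords X" "w \<in> fwords X"
    and "\<And>p. p \<in> set w \<Longrightarrow> letter p \<otimes> letter p = \<one>"
  shows "cost (u @ w @ rev w @ v) = cost (u @ v)"
  using assms
proof (induction w arbitrary: u v)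
  case Nil
  then show ?case by simp
next
  case (Cons p w)
  have "cost ((u @ [p]) @ w @ rev w @ ([p] @ v)) = cost ((u @ [p]) @ ([p] @ v))"
    using Cons.prems by (intro Cons.IH) auto
  also have "\<dots> = cost (u @ v)"
    using cost_cancel_pair[of u v p p] Cons.prems by simp
  finally show ?case by simp
qed

text \<open>To remove \<open>(s t)\<^sup>m\<close>, its first half is replaced by the braid relation, which turns the relator
  into a word followed by its reverse.\<close>

lemma cost_power_relator:
  assumes exchange and X: "fst p \<in> X" "fst q \<in> X"
    and inv: "letter p \<otimes> letter p = \<one>" "letter q \<otimes> letter q = \<one>"
    and pow: "(letter p \<otimes> letter q) [^] (m::nat) = \<one>" and uv: "u \<in> fwords X" "v \<in> fwords X"
  shows "cost (u @ concat (replicate m [p, q]) @ v) = cost (u @ v)"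
proof (rule antisym)
  have F: "alt p q m \<in> fwords X" "alt q p m \<in> fwords X" using X by (auto intro: alt_fwords)
  have W: "concat (replicate m [p, q]) = alt p q m @ rev (alt q p m)"
    by (rule alt_append_rev_alt[symmetric])
  show "cost (u @ concat (replicate m [p, q]) @ v) \<le> cost (u @ v)"
  proof (rule cost_insert_trivial)
    show "concat (replicate m [p, q]) \<in> fwords X" unfolding W using F by simp
    show "val (concat (replicate m [p, q])) = \<one>" using X pow by (simp add: val_power_word)
  qed fact+
  have "cost (u @ v) = cost (u @ alt q p m @ rev (alt q p m) @ v)"
    using \<open>exchange\<close> uv F inv set_alt[of q p m] by (intro cost_cancel_rev[symmetric]) auto
  also have "\<dots> \<le> cost (u @ alt p q m @ rev (alt q p m) @ v)"
    using X inv pow uv F by (intro cost_braid) auto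
  finally show "cost (u @ v) \<le> cost (u @ concat (replicate m [p, q]) @ v)"
    by (simp add: W)
qed

lemma cost_commute:
  assumes "u \<in> fwords X" "v \<in> fwords X" "fst p \<in> X" "fst q \<in> X"
    and "letter p \<otimes> letter q = letter q \<otimes> letter p"
  shows "cost (u @ [q, p] @ v) \<le> cost (u @ [p, q] @ v)"
proof (rule cost_replace)
  fix z assume "subseq z [p, q]"
  then have "z \<in> set (subseqs [p, q])" by (simp only: in_set_subseqs)
  then consider "z \<in> {[], [p], [q]}" | "z = [p, q]"
    by (auto simp: Let_def simp del: in_set_subseqs)
  then show "\<exists>z'. subseq z' [q, p] \<and> val z' = val z \<and>
      length z + length [q, p] \<le> length z' + length [p, q]"
  proof cases
    case 1
    then show ?thesis by (intro exI[of _ z]) auto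
  next
    case 2
    then show ?thesis using assms by (intro exI[of _ "[q, p]"]) auto
  qed
qed (use assms in auto)

end

section \<open>Groups with a presentation\<close>

text \<open>This is the presented group up to isomorphism, phrased through values of words in \<open>G\<close>, so that
  the classes of \<open>pres_rel\<close> need not be handled.\<close>

locale presented = marked_group +
  fixes R :: "('c fword \<times> 'c fword) set"
  assumes val_eq_iff: "u \<in> fwords X \<Longrightarrow> v \<in> fwords X \<Longrightarrow> val u = val v \<longleftrightarrow> (u, v) \<in> pres_rel X R"
    and val_surj: "g \<in> carrier G \<Longrightarrow> \<exists>u \<in> fwords X. val u = g"
begin

text \<open>The modulus is 0 or 2: with \<open>n = 0\<close> the divisibility is equality of the two counts, as
  in a right angled Artin group, and with \<open>n = 2\<close> only their parities agree, as in a Coxeter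
  group.\<close>

definition balanced :: "int \<Rightarrow> bool" where
  "balanced n \<longleftrightarrow> (\<forall>(l, r) \<in> R. l \<in> fwords X \<longrightarrow> r \<in> fwords X \<longrightarrow>
     (\<forall>\<tau> \<in> carrier G. n dvd crossings l \<tau> - crossings r \<tau>))"

lemma val_relation:
  assumes "(l, r) \<in> R" "l \<in> fwords X" "r \<in> fwords X"
  shows "val l = val r"
  using assms pres_rel.relation[of "[]" X "[]" l r R] by (simp add: val_eq_iff)

lemma crossings_replace:
  assumes "u \<in> fwords X" "v \<in> fwords X" "l \<in> fwords X" "r \<in> fwords X" "\<tau> \<in> carrier G"
    and "val l = val r" and lr: "\<And>\<tau>. \<tau> \<in> carrier G \<Longrightarrow> n dvd crossings l \<tau> - crossings r \<tau>"
  shows "n dvd crossings (u @ l @ v) \<tau> - crossings (u @ r @ v) \<tau>"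
  using assms(1-6) lr[of "inv (val u) \<otimes> \<tau> \<otimes> val u"] by (simp add: crossings_append)

lemma crossings_pres_rel:
  assumes "(u, v) \<in> pres_rel X R" "balanced n" "\<tau> \<in> carrier G"
  shows "n dvd crossings u \<tau> - crossings v \<tau>"
  using assms
proof (induction rule: pres_rel.induct)
  case (refl u)
  then show ?case by simp
next
  case (sym u v)
  then show ?case by (simp add: dvd_diff_commute)
next
  case (trans u v w)
  then have "n dvd (crossings u \<tau> - crossings v \<tau>) + (crossings v \<tau> - crossings w \<tau>)"
    by (intro dvd_add) auto
  then show ?case by simp
next
  case (cancel u v x b)
  have "val [(x, b), (x, \<not> b)] = val []"
    using cancel by (cases b) (auto simp: letter_def)
  then show ?case
    using cancel crossings_replace[of u v "[(x, b), (x, \<not> b)]" "[]" \<tau> n]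
    by (simp add: crossings_pair del: crossings.simps(2) val.simps(2))
next
  case (relation u v l r)
  then show ?case
    by (intro crossings_replace val_relation) (auto simp: balanced_def)
qed

text \<open>The word \<open>u\<close> is compared with \<open>y p y'\<close>, where \<open>y\<close> spells \<open>g\<close> and \<open>y'\<close> spells \<open>inv g\<close>. The wall is
  crossed by \<open>p\<close>. The crossings in \<open>y\<close> and \<open>y'\<close> add up to those of \<open>y y'\<close>, because \<open>p\<close> commutes with its
  own generator, and \<open>y y'\<close> is trivial.\<close>

lemma crossings_conjugate:
  assumes "balanced n" "u \<in> fwords X" "g \<in> carrier G" "fst p \<in> X"
    and u: "val u = g \<otimes> letter p \<otimes> inv g"
  shows "n dvd crossings u (g \<otimes> \<gamma> (fst p) \<otimes> inv g) - (if snd p then 1 else - 1)"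
proof -
  let ?x = "\<gamma> (fst p)" and ?e = "if snd p then 1 else - 1 :: int"
  let ?\<tau> = "g \<otimes> ?x \<otimes> inv g"
  obtain y where y: "y \<in> fwords X" "val y = g" using val_surj assms(3) by blast
  obtain y' where y': "y' \<in> fwords X" "val y' = inv g" using val_surj assms(3) by blast
  have x: "?x \<in> carrier G" "letter p \<in> carrier G" using assms by auto
  have "inv (letter p) \<otimes> ?x \<otimes> letter p = ?x"
    using assms(4) by (cases "snd p") (auto simp: letter_def m_assoc)
  moreover have "inv g \<otimes> ?\<tau> \<otimes> g = ?x" using assms(3) x by (simp add: m_assoc)
  ultimately have c: "crossings (y @ [p] @ y') ?\<tau> - ?e = crossings (y @ y') ?\<tau>"
    using y y' x assms(3,4) by (simp add: crossings_append)
  have "(u, y @ [p] @ y') \<in> pres_rel X R"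
    using y y' u assms x by (simp add: val_append m_assoc flip: val_eq_iff)
  then have "n dvd crossings u ?\<tau> - crossings (y @ [p] @ y') ?\<tau>"
    using assms x by (intro crossings_pres_rel) auto
  moreover have "(y @ y', []) \<in> pres_rel X R"
    using y y' assms(3) by (simp add: val_append flip: val_eq_iff)
  then have "n dvd crossings (y @ y') ?\<tau> - crossings [] ?\<tau>"
    using assms x by (intro crossings_pres_rel) auto
  ultimately have "n dvd (crossings u ?\<tau> - crossings (y @ [p] @ y') ?\<tau>) + crossings (y @ y') ?\<tau>"
    by simp
  moreover have "crossings u ?\<tau> - ?e
    = (crossings u ?\<tau> - crossings (y @ [p] @ y') ?\<tau>) + crossings (y @ y') ?\<tau>"
    using c by linarith
  ultimately show ?thesis by (simp only:)
qed

text \<open>Here the sign matters. For \<open>val u = \<tau>\<close> the count is 1, and for \<open>val u = inv \<tau>\<close> it is -1; so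
  the crossing that is deleted has the direction which cancels \<open>val u\<close> rather than squaring it.\<close>

lemma exchange_integral:
  assumes "balanced 0"
  shows exchange
  unfolding exchange_def
proof (intro ballI allI impI)
  fix u g p assume H: "u \<in> fwords X" "g \<in> carrier G" "fst p \<in> X" "val u = g \<otimes> letter p \<otimes> inv g"
  let ?\<tau> = "g \<otimes> \<gamma> (fst p) \<otimes> inv g"
  have \<tau>: "?\<tau> \<in> carrier G" using H by simp
  have c: "crossings u ?\<tau> = (if snd p then 1 else - 1)"
    using crossings_conjugate[OF assms H] by simp
  then obtain z where z: "subseq z u" "length z + 1 = length u"
    "val z = (if snd p then inv ?\<tau> else ?\<tau>) \<otimes> val u"
    using delete_crossing[OF H(1) \<tau>] by (auto split: if_splits)
  have "val z = \<one>"
    using z(3) H by (simp add: letter_def m_assoc inv_mult_group)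
  then show "\<exists>z. subseq z u \<and> length z + 1 = length u \<and> val z = \<one>" using z by blast
qed

text \<open>Here \<open>\<tau>\<close> is an involution, so either direction of the deleted crossing will do, and it is
  enough that the count is odd, hence nonzero.\<close>

lemma exchange_mod_two:
  assumes "balanced 2" and inv: "\<And>x. x \<in> X \<Longrightarrow> \<gamma> x \<otimes> \<gamma> x = \<one>"
  shows exchange
  unfolding exchange_def
proof (intro ballI allI impI)
  fix u g p assume H: "u \<in> fwords X" "g \<in> carrier G" "fst p \<in> X" "val u = g \<otimes> letter p \<otimes> inv g"
  let ?x = "\<gamma> (fst p)" let ?\<tau> = "g \<otimes> ?x \<otimes> inv g"
  have x: "?x \<in> carrier G" "inv ?x = ?x"
    using H inv[of "fst p"] inv_equality[of ?x ?x] by auto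
  then have \<tau>: "?\<tau> \<in> carrier G" "inv ?\<tau> = ?\<tau>" "val u = ?\<tau>"
    using H by (auto simp: letter_def inv_mult_group m_assoc)
  have "odd (crossings u ?\<tau>)"
    using crossings_conjugate[OF assms(1) H] by (auto split: if_splits)
  then have "crossings u ?\<tau> \<noteq> 0" by auto
  then obtain z where z: "subseq z u" "length z + 1 = length u" "val z = ?\<tau> \<otimes> val u"
    using delete_crossing[OF H(1) \<tau>(1)] \<tau>(2) by (auto split: if_splits)
  moreover have "?\<tau> \<otimes> val u = \<one>" using \<tau> by (metis r_inv)
  ultimately show "\<exists>z. subseq z u \<and> length z + 1 = length u \<and> val z = \<one>" by metis
qed

text \<open>The free cancelations are covered by the exchange property, which leaves the relations \<open>R\<close> to
  be checked.\<close>

lemma cancelation_length_unique: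
  assumes exchange
    and R: "\<And>u v l r. u \<in> fwords X \<Longrightarrow> v \<in> fwords X \<Longrightarrow> (l, r) \<in> R \<Longrightarrow> l \<in> fwords X \<Longrightarrow>
      r \<in> fwords X \<Longrightarrow> cost (u @ l @ v) = cost (u @ r @ v)"
    and S: "S \<subseteq> letter ` (X \<times> UNIV)"
    and "represents G S v g" "represents G S w g"
  shows "cancelation_length G v = cancelation_length G w"
proof -
  have lift: "\<exists>u \<in> fwords X. map letter u = v" if "set v \<subseteq> S" for v
  proof -
    have "v \<in> lists (letter ` (X \<times> UNIV))" using that S by auto
    then show ?thesis unfolding lists_image fwords_def by auto
  qed
  have cost_eq: "cost u = cost u'" if "(u, u') \<in> pres_rel X R" for u u'
    using that
  proof (induction rule: pres_rel.induct)
    case (cancel u v x b)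
    then show ?case
      using \<open>exchange\<close> by (intro cost_cancel_pair) (auto simp: letter_def)
  next
    case (relation u v l r)
    then show ?case by (intro R)
  qed auto
  obtain v' w' where v': "v' \<in> fwords X" "map letter v' = v" and w': "w' \<in> fwords X" "map letter w' = w"
    using lift assms(4,5) by (metis represents_def)
  then have "val v' = val w'"
    using assms(4,5) word_val_letters by (metis represents_def)
  then have "cost v' = cost w'" using v' w' by (intro cost_eq) (simp add: val_eq_iff)
  then show ?thesis using v' w' by (simp add: cost_def)
qed

end

lemma presented_iso:
  assumes "group G" "\<phi> \<in> iso (presented_group X R) G"
    and \<gamma>: "\<And>x. \<gamma> x = \<phi> (pres_gen X R x)"
  shows "presented G X \<gamma> R"
proof -
  let ?P = "presented_group X R" and ?c = "\<lambda>u. pres_rel X R `` {u}"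
  interpret G: group G by fact
  interpret P: group ?P by (rule group_presented_group)
  interpret \<phi>: group_hom ?P G \<phi>
    using assms(2) by unfold_locales (simp add: iso_def)
  have car: "carrier ?P = ?c ` fwords X"
    by (auto simp: presented_group_def quotient_def)
  interpret M: marked_group G X \<gamma>
    by unfold_locales (auto simp: \<gamma> pres_gen_def car intro!: \<phi>.hom_closed)
  have letter: "M.letter p = \<phi> (?c [p])" if "fst p \<in> X" for p
  proof (cases p)
    case (Pair x b)
    have "mult ?P (?c [(x, False)]) (?c [(x, True)]) = one ?P"
      using that Pair pres_rel.cancel[of "[]" X "[]" x False R]
      by (simp add: presented_group_mult equiv_class_eq[OF equiv_pres_rel])
        (simp add: presented_group_def)
    then have "inv\<^bsub>?P\<^esub> (?c [(x, True)]) = ?c [(x, False)]"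
      using that Pair by (intro P.inv_equality) (auto simp: car)
    then have "\<phi> (?c [(x, False)]) = inv\<^bsub>G\<^esub> (\<phi> (?c [(x, True)]))"
      using that Pair \<phi>.hom_inv[of "?c [(x, True)]"] by (simp add: car)
    then show ?thesis using Pair by (cases b) (auto simp: M.letter_def \<gamma> pres_gen_def)
  qed
  have val: "M.val u = \<phi> (?c u)" if "u \<in> fwords X" for u
    using that
  proof (induction u)
    case Nil
    then show ?case using \<phi>.hom_one by (simp add: presented_group_def)
  next
    case (Cons p u)
    then have "?c (p # u) = mult ?P (?c [p]) (?c u)"
      by (simp add: presented_group_mult)
    then show ?case using Cons letter[of p] by (simp add: car)
  qed
  have inj: "inj_on \<phi> (carrier ?P)" and surj: "\<phi> ` carrier ?P = carrier G"
    using assms(2) by (auto simp: iso_def bij_betw_def)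
  show ?thesis
  proof
    fix u v assume uv: "u \<in> fwords X" "v \<in> fwords X"
    then have "M.val u = M.val v \<longleftrightarrow> ?c u = ?c v"
      using inj by (simp add: val car inj_on_eq_iff)
    then show "M.val u = M.val v \<longleftrightarrow> (u, v) \<in> pres_rel X R"
      using uv eq_equiv_class_iff[OF equiv_pres_rel] by metis
  next
    fix g assume "g \<in> carrier G"
    then have "g \<in> (\<lambda>u. \<phi> (?c u)) ` fwords X"
      using surj by (simp add: car image_image)
    then show "\<exists>u \<in> fwords X. M.val u = g"
      using val by auto
  qed
qed

section \<open>The two families\<close>

lemma raag_cancelation_length_unique:
  assumes "right_angled_Artin_group V E G S" "represents G S v g" "represents G S w g"
  shows "cancelation_length G v = cancelation_length G w"
proof -
  let ?R = "raag_relations E"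
  obtain \<phi> where \<phi>: "\<phi> \<in> iso (presented_group V ?R) G" and "group G"
    and S: "S = \<phi> ` pres_gen V ?R ` V \<union> m_inv G ` \<phi> ` pres_gen V ?R ` V"
    using assms(1) by (auto simp: right_angled_Artin_group_def Let_def)
  define \<gamma> where "\<gamma> x = \<phi> (pres_gen V ?R x)" for x
  interpret presented G V \<gamma> ?R
    by (rule presented_iso) (fact \<open>group G\<close> \<phi> \<gamma>_def)+
  have edge: "\<exists>s t. l = [(s, True), (t, True)] \<and> r = [(t, True), (s, True)] \<and>
      s \<in> V \<and> t \<in> V \<and> \<gamma> s \<otimes>\<^bsub>G\<^esub> \<gamma> t = \<gamma> t \<otimes>\<^bsub>G\<^esub> \<gamma> s"
    if R: "(l, r) \<in> ?R" "l \<in> fwords V" "r \<in> fwords V" for l r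
  proof -
    obtain s t where st: "l = [(s, True), (t, True)]" "r = [(t, True), (s, True)]"
      using R(1) by (auto simp: raag_relations_def)
    then show ?thesis using val_relation[OF R] R(2) by (auto simp: letter_def)
  qed
  have "balanced 0"
    unfolding balanced_def
  proof clarify
    fix l r \<tau> assume "(l, r) \<in> ?R" "l \<in> fwords V" "r \<in> fwords V" and \<tau>: "\<tau> \<in> carrier G"
    then show "0 dvd crossings l \<tau> - crossings r \<tau>"
      using edge[of l r] crossings_commuting[OF _ _ _ \<tau>] by fastforce
  qed
  then have exchange by (rule exchange_integral)
  then show ?thesis
  proof (rule cancelation_length_unique)
    show "S \<subseteq> letter ` (V \<times> UNIV)"
      unfolding S letter_def by (force simp: image_iff \<gamma>_def)
    fix u v l r assume uv: "u \<in> fwords V" "v \<in> fwords V"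
      and "(l, r) \<in> ?R" "l \<in> fwords V" "r \<in> fwords V"
    then obtain s t where st: "l = [(s, True), (t, True)]" "r = [(t, True), (s, True)]"
      "s \<in> V" "t \<in> V" "\<gamma> s \<otimes>\<^bsub>G\<^esub> \<gamma> t = \<gamma> t \<otimes>\<^bsub>G\<^esub> \<gamma> s"
      using edge by blast
    show "cost (u @ l @ v) = cost (u @ r @ v)"
      unfolding st(1,2) using uv st(3-5)
      by (intro antisym cost_commute) (simp_all add: letter_def)
  qed fact+
qed

lemma Coxeter_cancelation_length_unique:
  assumes "Coxeter_group C m G S" "represents G S v g" "represents G S w g"
  shows "cancelation_length G v = cancelation_length G w"
proof -
  let ?R = "Coxeter_relations C m"
  obtain \<phi> where \<phi>: "\<phi> \<in> iso (presented_group C ?R) G" and "group G"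
    and S: "S = \<phi> ` pres_gen C ?R ` C"
    using assms(1) by (auto simp: Coxeter_group_def)
  define \<gamma> where "\<gamma> x = \<phi> (pres_gen C ?R x)" for x
  interpret presented G C \<gamma> ?R
    by (rule presented_iso) (fact \<open>group G\<close> \<phi> \<gamma>_def)+
  have inv: "\<gamma> s \<otimes>\<^bsub>G\<^esub> \<gamma> s = \<one>\<^bsub>G\<^esub>" if "s \<in> C" for s
    using that val_relation[of "[(s, True), (s, True)]" "[]"]
    by (auto simp: Coxeter_relations_def letter_def)
  \<comment> \<open>The relator \<open>s s\<close> is included as the power \<open>(s t)\<^sup>k\<close> with \<open>t = s\<close> and \<open>k = 1\<close>.\<close>
  have relator: "r = [] \<and> (\<exists>s t k. s \<in> C \<and> t \<in> C \<and> (\<gamma> s \<otimes>\<^bsub>G\<^esub> \<gamma> t) [^]\<^bsub>G\<^esub> (k::nat) = \<one>\<^bsub>G\<^esub> \<and>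
      l = concat (replicate k [(s, True), (t, True)]))"
    if R: "(l, r) \<in> ?R" "l \<in> fwords C" "r \<in> fwords C" for l r
  proof -
    consider s where "s \<in> C" "l = [(s, True), (s, True)]" "r = []"
      | s t k where "s \<in> C" "t \<in> C" "l = concat (replicate k [(s, True), (t, True)])" "r = []"
      using R(1) by (auto simp: Coxeter_relations_def)
    then show ?thesis
    proof cases
      case 1
      then have "l = concat (replicate 1 [(s, True), (s, True)])" by simp
      moreover have "(\<gamma> s \<otimes>\<^bsub>G\<^esub> \<gamma> s) [^]\<^bsub>G\<^esub> (1::nat) = \<one>\<^bsub>G\<^esub>" using inv 1 by simp
      ultimately show ?thesis using 1 by blast
    next
      case 2
      then have "(\<gamma> s \<otimes>\<^bsub>G\<^esub> \<gamma> t) [^]\<^bsub>G\<^esub> k = \<one>\<^bsub>G\<^esub>"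
        using val_relation[OF R] val_power_word[of "(s, True)" "(t, True)" k]
        by (simp add: letter_def)
      then show ?thesis using 2 by blast
    qed
  qed
  have "balanced 2"
    unfolding balanced_def
  proof clarify
    fix l r \<tau> assume "(l, r) \<in> ?R" "l \<in> fwords C" "r \<in> fwords C" and \<tau>: "\<tau> \<in> carrier G"
    then obtain s t k where "r = []" "s \<in> C" "t \<in> C" "(\<gamma> s \<otimes>\<^bsub>G\<^esub> \<gamma> t) [^]\<^bsub>G\<^esub> (k::nat) = \<one>\<^bsub>G\<^esub>"
      "l = concat (replicate k [(s, True), (t, True)])"
      using relator by blast
    then show "2 dvd crossings l \<tau> - crossings r \<tau>"
      using crossings_power_word_even[of s t \<tau> k] inv \<tau> by simp
  qed
  then have exchange using inv by (rule exchange_mod_two)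
  then show ?thesis
  proof (rule cancelation_length_unique)
    show "S \<subseteq> letter ` (C \<times> UNIV)"
      unfolding S letter_def by (force simp: image_iff \<gamma>_def)
    fix u v l r assume uv: "u \<in> fwords C" "v \<in> fwords C"
      and "(l, r) \<in> ?R" "l \<in> fwords C" "r \<in> fwords C"
    then obtain s t k where st: "r = []" "s \<in> C" "t \<in> C" "(\<gamma> s \<otimes>\<^bsub>G\<^esub> \<gamma> t) [^]\<^bsub>G\<^esub> (k::nat) = \<one>\<^bsub>G\<^esub>"
      "l = concat (replicate k [(s, True), (t, True)])"
      using relator by blast
    show "cost (u @ l @ v) = cost (u @ r @ v)"
      using cost_power_relator[OF \<open>exchange\<close>, of "(s, True)" "(t, True)" k u v] uv st inv
      by (simp add: letter_def)
  qed fact+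
qed

theorem theorem1p2:
  fixes G :: "('a, 'b) monoid_scheme" and S :: "'a set"
    and V :: "'v set" and E :: "'v set set"
    and C :: "'s set" and m :: "'s \<Rightarrow> 's \<Rightarrow> enat"
  assumes "right_angled_Artin_group V E G S \<or> Coxeter_group C m G S"
  shows "(\<forall>g \<in> carrier G. \<forall>v w. represents G S v g \<and> represents G S w g
            \<longrightarrow> cancelation_length G v = cancelation_length G w) \<and>
         (\<forall>g \<in> carrier G. \<forall>w. represents G S w g
            \<longrightarrow> cancelation_norm G S g = cancelation_length G w)"
proof -
  have unique: "cancelation_length G v = cancelation_length G w"
    if "represents G S v g" "represents G S w g" for v w g
    using assms that raag_cancelation_length_unique Coxeter_cancelation_length_unique by metis
  have "cancelation_norm G S g = cancelation_length G w" if "represents G S w g" for w g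
    unfolding cancelation_norm_def
  proof (rule Least_equality)
    show "\<exists>w'. represents G S w' g \<and> cancelation_length G w' = cancelation_length G w"
      using that by blast
    fix k assume "\<exists>w'. represents G S w' g \<and> cancelation_length G w' = k"
    then obtain w' where "represents G S w' g" "cancelation_length G w' = k" by blast
    then show "cancelation_length G w \<le> k"
      using unique[OF that] by simp
  qed
  then show ?thesis using unique by blast
qed

end
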